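(* There exist a basis $C = \{c_n\}_{n=0}^{\infty}$ of order $2$ (for the nonnegative integers), consisting of nonnegative integers $c_0 < c_1 < c_2 < \cdots$, and a real number $\lambda > 0$ such that $$c_n = \lambda n^2 + O(n).$$
   Context: A set $C$ of nonnegative integers is a basis of order $2$ (for the set $\mathbf{N}_0$ of nonnegative integers) if every nonnegative integer is the sum of exactly two, not necessarily distinct, elements of $C$. The notation $c_n = \lambda n^2 + O(n)$ means that there is a constant $K>0$ such that $|c_n - \lambda n^2| \leq K n$ for all $n \geq 1$. *)

theory Defs
  imports Complex_Main
begin

definition basis_of_order_two :: "nat set \<Rightarrow> bool" where
  "basis_of_order_two C \<longleftrightarrow> (\<forall>m. \<exists>a\<in>C. \<exists>b\<in>C. m = a + b)"

end

(* With x i = 25 * 4 ^ i and q i = 2 ^ i + 3, let A consist on each block [x i, x (i + 1)) of an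
   arithmetic progression of difference q i.  The differences q i, q (i + 1), q (i + 2) are pairwise
   coprime, so by the Chinese remainder theorem a window of length q i * q j in block i suffices
   to represent a given n as a sum of an element of block i and one of block j = i + 1 or i + 2;
   the blocks are long enough for these representations to cover every n >= 150.  The gaps of A
   near a are at least sqrt a / 10, so that every interval [n^2 / 900, (n + 1)^2 / 900) contains at
   most one element of A.  Choosing one integer from each of these intervals with n >= 900, namely
   the element of A whenever there is one, and adding all integers below 900 yields a basis with
   c n = n^2 / 900 + O(n). *)

theory Submission
  imports Defs "HOL-Number_Theory.Cong" "HOL-Library.Discrete_Functions"
begin

text \<open>Both requirements are congruences for the offset \<open>a - s\<close>, one modulo
  \<open>p\<close> and one modulo \<open>q\<close>, so the Chinese remainder theorem finds it below
  \<open>p * q\<close>. The bound on \<open>n\<close> keeps \<open>n - a\<close> from being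
  truncated at 0.\<close>

lemma sum_of_congruence_classes_window:
  fixes p q s x y n :: nat
  assumes "coprime p q" "p > 0" "q > 0" "s + p * q \<le> n"
  obtains a where "s \<le> a" "a < s + p * q" "[a = x] (mod p)" "[n - a = y] (mod q)"
proof -
  \<comment> \<open>Integers, since \<open>x - s\<close> and \<open>n - y - s\<close> may be
    negative.\<close>
  obtain w where w: "[w = int x - int s] (mod int p)" "[w = int n - int y - int s] (mod int q)"
    using binary_chinese_remainder_int[of "int p" "int q"] assms(1) by auto
  define z where "z = nat (w mod int (p * q))"
  have z: "int z = w mod int (p * q)" and "z < p * q"
    using assms(2,3) by (auto simp: z_def nat_less_iff)
  have "[int z = w] (mod int p)" "[int z = w] (mod int q)"
    unfolding z by (auto simp: cong_def mod_mod_cancel)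
  with w have p: "[int z = int x - int s] (mod int p)"
    and q: "[int z = int n - int y - int s] (mod int q)"
    by (blast intro: cong_trans)+
  have "[int (s + z) = int x] (mod int p)"
    using cong_add[OF cong_refl p, of "int s"] by simp
  moreover have "[int (n - (s + z)) = int y] (mod int q)"
    using cong_diff[OF cong_refl q, of "int n - int s"] \<open>z < p * q\<close> assms(4)
    by (simp add: of_nat_diff algebra_simps)
  ultimately show ?thesis
    using that[of "s + z"] \<open>z < p * q\<close> by (simp add: cong_int_iff del: of_nat_add)
qed

definition block :: "nat \<Rightarrow> nat set" where
  "block i = {a. 25 * 4 ^ i \<le> a \<and> a + (2 ^ i + 3) \<le> 25 * 4 ^ Suc i \<and> [a = 25 * 4 ^ i] (mod 2 ^ i + 3)}"

text \<open>The inequalities place the window of length \<open>q i * q j\<close> at \<open>s\<close>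
  inside the range of block \<open>i\<close>, and its reflection under \<open>n - a\<close> inside
  that of block \<open>j\<close>; only the two congruences remain to be met.\<close>

lemma sum_of_blocks:
  fixes s n :: nat
  defines "\<And>i. q i \<equiv> 2 ^ i + 3"
  assumes "coprime (q i) (q j)"
    and "25 * 4 ^ i \<le> s" "s + q i * q j + q i \<le> 25 * 4 ^ Suc i"
    and "25 * 4 ^ j + s + q i * q j \<le> n" "n + q j \<le> 25 * 4 ^ Suc j + s"
  shows "\<exists>a\<in>block i. \<exists>b\<in>block j. n = a + b"
proof -
  have "q i > 0" "q j > 0" by (simp_all add: q_def)
  then obtain a where "s \<le> a" "a < s + q i * q j"
    "[a = 25 * 4 ^ i] (mod q i)" "[n - a = 25 * 4 ^ j] (mod q j)"
    using sum_of_congruence_classes_window[of "q i" "q j" s n "25 * 4 ^ i" "25 * 4 ^ j"] assms(2,5)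
    by auto
  with assms(3-6) have "a \<in> block i" "n - a \<in> block j" "n = a + (n - a)"
    unfolding block_def q_def by auto
  then show ?thesis by blast
qed

lemma coprime_3_power_2_add_3: "coprime 3 (2 ^ i + 3 :: nat)"
proof -
  have "coprime 3 (2 :: nat)" using coprime_Suc_left_nat[of 2] by (simp add: numeral_3_eq_3)
  then have "coprime 3 (2 ^ i :: nat)" by simp
  then show ?thesis by (simp only: coprime_iff_gcd_eq_1 gcd_add2 add.commute[of _ 3])
qed

text \<open>Twice the first difference exceeds the next one by 3, and four times it exceeds the one
  after that by 9. A common divisor thus divides 9, while \<open>2 ^ i + 3\<close> is coprime to
  3.\<close>

lemma coprime_block_differences:
  shows "coprime (2 ^ i + 3) (2 ^ Suc i + 3 :: nat)"
    and "coprime (2 ^ i + 3) (2 ^ Suc (Suc i) + 3 :: nat)"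
proof -
  have step: "coprime (2 ^ i + 3) m" if "c dvd 9" "m + c = k * (2 ^ i + 3)" for k c m :: nat
  proof (rule coprimeI)
    fix d :: nat assume d: "d dvd 2 ^ i + 3" "d dvd m"
    then have "d dvd c" using that(2) by (metis dvd_add_right_iff dvd_mult)
    then have "d dvd 3 ^ 2" using that(1) by (auto intro: dvd_trans)
    moreover have "coprime d (3 ^ 2)"
      using coprime_3_power_2_add_3[of i] d(1)
      by (metis coprime_commute coprime_divisors coprime_power_right_iff dvd_refl)
    ultimately show "is_unit d" by (metis coprime_common_divisor dvd_refl)
  qed
  show "coprime (2 ^ i + 3) (2 ^ Suc i + 3 :: nat)" by (rule step[of 3 _ 2]) auto
  show "coprime (2 ^ i + 3) (2 ^ Suc (Suc i) + 3 :: nat)" by (rule step[of 9 _ 4]) auto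
qed

lemma four_power_scale:
  fixes n :: nat
  assumes "150 \<le> n"
  obtains i where "150 * 4 ^ i \<le> n" "n < 600 * 4 ^ i"
proof -
  have "\<exists>i. 150 * 4 ^ i \<le> n \<and> n < 600 * 4 ^ i"
  proof -
    have "1 \<le> n div 150" using assms by linarith
    then obtain i where "4 ^ i \<le> n div 150" "n div 150 < 4 ^ (i + 1)"
      using ex_power_ivl1[of 4 "n div 150"] by auto
    then have "150 * 4 ^ i \<le> n" "n < 600 * 4 ^ i" by simp_all
    then show ?thesis by blast
  qed
  with that show ?thesis by blast
qed

lemma large_sum_of_blocks:
  fixes n :: nat
  assumes "150 \<le> n"
  shows "\<exists>a\<in>\<Union>(range block). \<exists>b\<in>\<Union>(range block). n = a + b"
proof -
  obtain i where i: "150 * 4 ^ i \<le> n" "n < 600 * 4 ^ i"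
    using assms by (rule four_power_scale)
  have Q: "(1 :: nat) \<le> 2 ^ i" "(2 :: nat) ^ i \<le> 4 ^ i" by (simp_all add: power_mono)
  have "(2 :: nat) ^ i * 2 ^ i = 4 ^ i" by (simp flip: power_mult_distrib)
  then have prods: "(2 ^ i + 3) * (2 ^ Suc i + 3) = 2 * 4 ^ i + 9 * 2 ^ i + (9 :: nat)"
    "(2 ^ i + 3) * (2 ^ Suc (Suc i) + 3) = 4 * 4 ^ i + 15 * 2 ^ i + (9 :: nat)"
    by (simp_all add: algebra_simps)
  \<comment> \<open>With \<open>j = Suc i\<close>, a window at the start of block \<open>i\<close>
    works up to \<open>425 * 4 ^ i\<close> minus one difference of block \<open>j\<close>. Moving it
    up by \<open>50 * 4 ^ i\<close> raises this limit by the same amount, which bridges the stretch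
    up to about \<open>453 * 4 ^ i\<close>, where block \<open>Suc (Suc i)\<close> takes
    over.\<close>
  consider "n \<le> 420 * 4 ^ i" | "420 * 4 ^ i < n" "n \<le> 460 * 4 ^ i" | "460 * 4 ^ i < n"
    by linarith
  then have "(\<exists>a\<in>block i. \<exists>b\<in>block (Suc i). n = a + b) \<or> (\<exists>a\<in>block i. \<exists>b\<in>block (Suc (Suc i)). n = a + b)"
  proof cases
    case 1
    show ?thesis
      by (rule disjI1, rule sum_of_blocks[where s = "25 * 4 ^ i"], rule coprime_block_differences)
        (use i 1 Q in \<open>simp_all only: prods, simp_all only: power_Suc\<close>)
  next
    case 2
    show ?thesis
      by (rule disjI1, rule sum_of_blocks[where s = "75 * 4 ^ i"], rule coprime_block_differences)
        (use i 2 Q in \<open>simp_all only: prods, simp_all only: power_Suc\<close>)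
  next
    case 3
    show ?thesis
      by (rule disjI2, rule sum_of_blocks[where s = "25 * 4 ^ i"], rule coprime_block_differences)
        (use i 3 Q in \<open>simp_all only: prods, simp_all only: power_Suc\<close>)
  qed
  then show ?thesis by blast
qed

lemma block_gap:
  assumes "a \<in> block i" "b \<in> block j" "a < b"
  shows "a + 2 ^ i + 3 \<le> b"
proof (cases "i = j")
  case True
  with assms have "[b = a] (mod 2 ^ i + 3)"
    unfolding block_def by (auto intro: cong_trans cong_sym)
  then have "2 ^ i + 3 dvd b - a"
    using \<open>a < b\<close> by (simp add: cong_altdef_nat)
  with \<open>a < b\<close> show ?thesis by (auto dest: dvd_imp_le)
next
  case False
  have "Suc i \<le> j"
  proof (rule ccontr)
    assume "\<not> Suc i \<le> j"
    with False have "Suc j \<le> i" by simp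
    then have "(4 :: nat) ^ Suc j \<le> 4 ^ i" by (intro power_increasing) auto
    with assms show False by (auto simp: block_def)
  qed
  then have "(4 :: nat) ^ Suc i \<le> 4 ^ j" by (intro power_increasing) auto
  with assms show ?thesis by (auto simp: block_def)
qed

text \<open>For \<open>a < b\<close> with \<open>a\<close> in block \<open>i\<close>, a common root
  \<open>n\<close> forces \<open>900 * (b - a) \<le> 2 * n < 600 * 2 ^ i\<close>, whereas the block
  gap makes the left side at least \<open>900 * 2 ^ i\<close>.\<close>

lemma floor_sqrt_block_inj:
  assumes "a \<in> \<Union>(range block)" "b \<in> \<Union>(range block)"
    and "floor_sqrt (900 * a) = floor_sqrt (900 * b)"
  shows "a = b"
proof -
  have False if "a \<in> block i" "b \<in> block j" "a < b"
    "floor_sqrt (900 * a) = floor_sqrt (900 * b)" for a b i j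
  proof -
    define n where "n = floor_sqrt (900 * a)"
    have n: "n\<^sup>2 \<le> 900 * a" by (simp add: n_def)
    have "a < 100 * 4 ^ i" using that(1) by (auto simp: block_def)
    with n have "n\<^sup>2 < 90000 * 4 ^ i" by linarith
    also have "\<dots> = (300 * 2 ^ i)\<^sup>2"
      by (simp add: power2_eq_square flip: power_mult_distrib)
    finally have "n < 300 * 2 ^ i" by (rule power2_less_imp_less) simp
    moreover have "900 * b < (Suc n)\<^sup>2"
      unfolding n_def that(4) by (rule Suc_floor_sqrt_power2_gt)
    then have "900 * b \<le> n\<^sup>2 + 2 * n" by (simp add: power2_eq_square)
    moreover have "a + 2 ^ i \<le> b" using block_gap[OF that(1-3)] by simp
    ultimately show False using n by linarith
  qed
  with assms show ?thesis by (metis UN_E nat_neq_iff)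
qed

lemma ex_floor_sqrt_mult_eq:
  fixes w n :: nat
  assumes "0 < w" "w \<le> n"
  shows "\<exists>m. floor_sqrt (w * m) = n"
proof -
  \<comment> \<open>Rounding \<open>n\<^sup>2 / w\<close> up adds less than \<open>w\<close> to the
    product \<open>w * m\<close>, and \<open>w \<le> n\<close> keeps it below
    \<open>(n + 1)\<^sup>2\<close>.\<close>
  define m where "m = (n\<^sup>2 + w - 1) div w"
  have "w * m + (n\<^sup>2 + w - 1) mod w = n\<^sup>2 + w - 1" unfolding m_def by simp
  moreover have "(n\<^sup>2 + w - 1) mod w < w" using assms(1) by simp
  ultimately have "n\<^sup>2 \<le> w * m" "w * m < n\<^sup>2 + w" by linarith+
  with assms(2) have "floor_sqrt (w * m) = n"
    by (intro floor_sqrt_unique) (auto simp: power2_eq_square)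
  then show ?thesis ..
qed

lemma superset_with_quadratic_enumeration:
  fixes A :: "nat set" and w :: nat
  assumes "0 < w" and inj: "inj_on (\<lambda>a. floor_sqrt (w * a)) A"
  obtains c :: "nat \<Rightarrow> nat" where "strict_mono c" "A \<subseteq> range c" "\<And>n. n < w \<Longrightarrow> c n = n"
    "\<And>n. w \<le> n \<Longrightarrow> floor_sqrt (w * c n) = n"
proof -
  define e where "e n = (if \<exists>a\<in>A. floor_sqrt (w * a) = n
    then SOME a. a \<in> A \<and> floor_sqrt (w * a) = n else SOME a. floor_sqrt (w * a) = n)" for n
  \<comment> \<open>For \<open>n < w\<close> the root \<open>n\<close> may not be attained by any
    multiple of \<open>w\<close>, leaving \<open>e n\<close> unspecified; hence \<open>e\<close> is
    used only from \<open>w\<close> on.\<close>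
  define c where "c n = (if n < w then n else e n)" for n
  have e: "floor_sqrt (w * e n) = n" if "w \<le> n" for n
  proof (cases "\<exists>a\<in>A. floor_sqrt (w * a) = n")
    case True
    then show ?thesis unfolding e_def
      using someI_ex[of "\<lambda>a. a \<in> A \<and> floor_sqrt (w * a) = n"] by auto
  next
    case False
    then show ?thesis unfolding e_def using someI_ex[OF ex_floor_sqrt_mult_eq[OF assms(1) that]] by auto
  qed
  \<comment> \<open>The threshold is the same for values and roots because
    \<open>w\<^sup>2 \<le> w * a\<close> means \<open>w \<le> a\<close>. So the initial identity
    segment and the chosen values do not interleave.\<close>
  have small: "a < w \<longleftrightarrow> floor_sqrt (w * a) < w" for a
  proof -
    have "w \<le> floor_sqrt (w * a) \<longleftrightarrow> w \<le> a"
      using assms(1) by (simp add: le_floor_sqrt_iff power2_eq_square)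
    then show ?thesis by linarith
  qed
  have "e (floor_sqrt (w * a)) = a" if "a \<in> A" for a
  proof -
    have "e (floor_sqrt (w * a)) \<in> A \<and> floor_sqrt (w * e (floor_sqrt (w * a))) = floor_sqrt (w * a)"
      unfolding e_def using that someI[of "\<lambda>b. b \<in> A \<and> floor_sqrt (w * b) = floor_sqrt (w * a)" a] by auto
    with that inj show ?thesis by (auto dest: inj_onD)
  qed
  then have "c (if a < w then a else floor_sqrt (w * a)) = a" if "a \<in> A" for a
    using that small[of a] by (simp add: c_def)
  then have "A \<subseteq> range c" by (metis rangeI subsetI)
  moreover have "strict_mono c"
  proof (rule strict_monoI)
    fix m n :: nat assume "m < n"
    show "c m < c n"
    proof (cases "m < w")
      case True
      then show ?thesis using \<open>m < n\<close> small[of "e n"] e[of n] by (auto simp: c_def)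
    next
      case False
      then have "floor_sqrt (w * e m) < floor_sqrt (w * e n)" using \<open>m < n\<close> by (simp add: e)
      then have "e m < e n" by (metis mono_floor_sqrt' mult_le_mono2 not_le)
      then show ?thesis using False \<open>m < n\<close> by (simp add: c_def)
    qed
  qed
  ultimately show ?thesis using that e by (simp add: c_def)
qed

theorem theorem8:
  shows "\<exists>(C :: nat set) (c :: nat \<Rightarrow> nat) (l :: real).
    basis_of_order_two C \<and> C = range c \<and> strict_mono c \<and> l > 0 \<and>
    (\<exists>K :: real. K > 0 \<and> (\<forall>n :: nat. n \<ge> 1 \<longrightarrow> \<bar>real (c n) - l * (real n)\<^sup>2\<bar> \<le> K * real n))"
proof -
  have "inj_on (\<lambda>a. floor_sqrt (900 * a)) (\<Union>(range block))"
    using floor_sqrt_block_inj by (intro inj_onI) blast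
  then obtain c :: "nat \<Rightarrow> nat" where c: "strict_mono c" "\<Union>(range block) \<subseteq> range c"
    and small: "\<And>n. n < 900 \<Longrightarrow> c n = n" and large: "\<And>n. 900 \<le> n \<Longrightarrow> floor_sqrt (900 * c n) = n"
    using superset_with_quadratic_enumeration[of 900 "\<Union>(range block)"] by auto
  have "\<exists>a\<in>range c. \<exists>b\<in>range c. n = a + b" for n
  proof (cases "n < 900")
    case True
    then have "n = c n + c 0" by (simp add: small)
    then show ?thesis by blast
  next
    case False
    then have "150 \<le> n" by simp
    from large_sum_of_blocks[OF this] obtain a b
      where "a \<in> \<Union>(range block)" "b \<in> \<Union>(range block)" and "n = a + b" by (elim bexE)
    with c(2) have "a \<in> range c" "b \<in> range c" by (simp_all only: subsetD)
    with \<open>n = a + b\<close> show ?thesis by (intro bexI)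
  qed
  then have "basis_of_order_two (range c)" by (simp add: basis_of_order_two_def)
  \<comment> \<open>For \<open>n < 900\<close> the deviation is \<open>n - n\<^sup>2 / 900\<close>,
    between 0 and \<open>n\<close>; from 900 on it lies between 0 and \<open>2 * n / 900\<close>.
    Hence \<open>K = 1\<close> serves both ranges.\<close>
  moreover have "\<bar>real (c n) - 1 / 900 * (real n)\<^sup>2\<bar> \<le> 1 * real n" if "1 \<le> n" for n
  proof (cases "n < 900")
    case True
    then have "real n * real n \<le> 900 * real n" by (intro mult_right_mono) auto
    then show ?thesis by (simp add: small[OF True] power2_eq_square)
  next
    case False
    then have "n\<^sup>2 \<le> 900 * c n" "900 * c n < (Suc n)\<^sup>2"
      using floor_sqrt_power2_le[of "900 * c n"] Suc_floor_sqrt_power2_gt[of "900 * c n"]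
      by (simp_all add: large)
    then have "n\<^sup>2 \<le> 900 * c n" "900 * c n \<le> n\<^sup>2 + 2 * n"
      by (simp_all add: power2_eq_square)
    then have "real (n\<^sup>2) \<le> real (900 * c n)" "real (900 * c n) \<le> real (n\<^sup>2 + 2 * n)"
      by (simp_all only: of_nat_le_iff)
    then show ?thesis by simp
  qed
  ultimately show ?thesis
    using c(1) by (intro exI[of _ "range c"] exI[of _ c] exI[of _ "1 / 900"] conjI exI[of _ 1]) auto
qed

end
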